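(* Every separable, first-countable, causally path-connected Lorentzian metric space $X$ (in the sense of Bykov–Minguzzi–Suhr) with compact causal diamonds, empty bubbling boundary, and empty spacelike boundary has a strong Cauchy time function.
   Context: A Lorentzian metric space (Bykov–Minguzzi–Suhr) is a set $X$ with a function $d:X\times X\to[0,\infty)$ such that (1) $d(x,y)+d(y,z)\le d(x,z)$ whenever $d(x,y)>0$ and $d(y,z)>0$; (2) there is a topology on $X$ for which $d$ is continuous with respect to the product topology and for which, for all $x,y\in X$ and $\varepsilon>0$, the set $\{(x',y'):d(x',y')\ge\varepsilon\}\cap(\overline{I(x,y)}\times\overline{I(x,y)})$ is compact, where $I(x,y)=\{z:d(x,z)>0,\ d(z,y)>0\}$; (3) for all $x\ne y$ there is $z$ with $d(x,z)\ne d(y,z)$ or $d(z,x)\ne d(z,y)$. It is always equipped with some topology as in (2). Its timelike relation is $x\ll y$ iff $d(x,y)>0$, and its causal relation is $x\le y$ iff $d(z,x)\le d(z,y)$ and $d(y,z)\le d(x,z)$ for all $z\in X$. $J^+(x)=\{y:x\le y\}$, $J^-(x)=\{y:y\le x\}$, $I^+(x)=\{y:x\ll y\}$, $I^-(x)=\{y:y\ll x\}$. Causal diamonds are the sets $J^+(x)\cap J^-(y)$. $\partial^\pm_{ca}X=\{x:J^\pm(x)=\{x\}\}$, $\partial^\pm_{ch}X=\{x:I^\pm(x)=\emptyset\}$. The bubbling boundary is empty if $\partial^+_{ca}X=\partial^+_{ch}X$ and $\partial^-_{ca}X=\partial^-_{ch}X$. The spacelike boundary is $\partial^+_{ch}X\cap\partial^-_{ch}X$.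 Curves are continuous maps from intervals $I\subset\mathbb{R}$ to $X$. A curve $\gamma:I\to X$ is causal if $t<s$ for $t,s\in I$ implies $\gamma(t)\le\gamma(s)$. $X$ is causally path-connected if any $x,y\in X$ with $x\le y$ can be connected by a causal curve. A causal curve $\gamma:I\to X$ is future extendible if there exist an order-preserving homeomorphism $\varphi:I\to\hat I$ onto an interval $\hat I\subset\mathbb{R}$, an interval $\tilde I\subset\mathbb{R}$ containing $\hat I$ and some $t\in\tilde I$ with $t>s$ for all $s\in\hat I$, and a causal curve $\tilde\gamma:\tilde I\to X$ with $\tilde\gamma|_{\hat I}=\gamma\circ\varphi^{-1}$; otherwise it is future inextendible. Past versions are analogous; inextendible means both future and past inextendible. A continuous function $\tau:X\to[-\infty,\infty]$ is a time function if $\tau(x)<\tau(y)$ whenever $x\le y$ and $x\ne y$. It is a strong Cauchy time function if in addition for every inextendible causal curve $\gamma:I\to X$ defined on an interval $I\subset\mathbb{R}$ one has $\lim_{t\searrow\inf I}(\tau\circ\gamma)(t)=-\infty$ and $\lim_{t\nearrow\sup I}(\tau\circ\gamma)(t)=\infty$. *)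

theory Defs
  imports "HOL-Analysis.Analysis"
begin

definition chron_diamond :: "'a set \<Rightarrow> ('a \<Rightarrow> 'a \<Rightarrow> real) \<Rightarrow> 'a \<Rightarrow> 'a \<Rightarrow> 'a set"
  where "chron_diamond X d x y = {z \<in> X. d x z > 0 \<and> d z y > 0}"

definition admissible_topology :: "'a set \<Rightarrow> ('a \<Rightarrow> 'a \<Rightarrow> real) \<Rightarrow> 'a topology \<Rightarrow> bool"
  where "admissible_topology X d T \<longleftrightarrow>
    topspace T = X \<and>
    continuous_map (prod_topology T T) euclideanreal (\<lambda>(x, y). d x y) \<and>
    (\<forall>x\<in>X. \<forall>y\<in>X. \<forall>\<epsilon>>0.
       compactin (prod_topology T T)
         ({(x', y') \<in> X \<times> X. d x' y' \<ge> \<epsilon>} \<inter>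
          ((T closure_of chron_diamond X d x y) \<times> (T closure_of chron_diamond X d x y))))"

locale lorentzian_metric_space =
  fixes X :: "'a set" and d :: "'a \<Rightarrow> 'a \<Rightarrow> real"
  assumes nonneg: "x \<in> X \<Longrightarrow> y \<in> X \<Longrightarrow> 0 \<le> d x y"
    and reverse_triangle:
      "x \<in> X \<Longrightarrow> y \<in> X \<Longrightarrow> z \<in> X \<Longrightarrow> d x y > 0 \<Longrightarrow> d y z > 0 \<Longrightarrow> d x y + d y z \<le> d x z"
    and ex_admissible_topology: "\<exists>T. admissible_topology X d T"
    and distinguishing:
      "x \<in> X \<Longrightarrow> y \<in> X \<Longrightarrow> x \<noteq> y \<Longrightarrow> \<exists>z\<in>X. d x z \<noteq> d y z \<or> d z x \<noteq> d z y"

definition causal_le :: "'a set \<Rightarrow> ('a \<Rightarrow> 'a \<Rightarrow> real) \<Rightarrow> 'a \<Rightarrow> 'a \<Rightarrow> bool"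
  where "causal_le X d x y \<longleftrightarrow> (\<forall>z\<in>X. d z x \<le> d z y \<and> d y z \<le> d x z)"

definition causal_future :: "'a set \<Rightarrow> ('a \<Rightarrow> 'a \<Rightarrow> real) \<Rightarrow> 'a \<Rightarrow> 'a set"
  where "causal_future X d x = {y \<in> X. causal_le X d x y}"

definition causal_past :: "'a set \<Rightarrow> ('a \<Rightarrow> 'a \<Rightarrow> real) \<Rightarrow> 'a \<Rightarrow> 'a set"
  where "causal_past X d x = {y \<in> X. causal_le X d y x}"

definition chron_future :: "'a set \<Rightarrow> ('a \<Rightarrow> 'a \<Rightarrow> real) \<Rightarrow> 'a \<Rightarrow> 'a set"
  where "chron_future X d x = {y \<in> X. d x y > 0}"

definition chron_past :: "'a set \<Rightarrow> ('a \<Rightarrow> 'a \<Rightarrow> real) \<Rightarrow> 'a \<Rightarrow> 'a set"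
  where "chron_past X d x = {y \<in> X. d y x > 0}"

definition compact_causal_diamonds ::
    "'a set \<Rightarrow> ('a \<Rightarrow> 'a \<Rightarrow> real) \<Rightarrow> 'a topology \<Rightarrow> bool"
  where "compact_causal_diamonds X d T \<longleftrightarrow>
    (\<forall>x\<in>X. \<forall>y\<in>X. compactin T (causal_future X d x \<inter> causal_past X d y))"

definition future_causal_boundary :: "'a set \<Rightarrow> ('a \<Rightarrow> 'a \<Rightarrow> real) \<Rightarrow> 'a set"
  where "future_causal_boundary X d = {x \<in> X. causal_future X d x = {x}}"

definition past_causal_boundary :: "'a set \<Rightarrow> ('a \<Rightarrow> 'a \<Rightarrow> real) \<Rightarrow> 'a set"
  where "past_causal_boundary X d = {x \<in> X. causal_past X d x = {x}}"

definition future_chron_boundary :: "'a set \<Rightarrow> ('a \<Rightarrow> 'a \<Rightarrow> real) \<Rightarrow> 'a set"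
  where "future_chron_boundary X d = {x \<in> X. chron_future X d x = {}}"

definition past_chron_boundary :: "'a set \<Rightarrow> ('a \<Rightarrow> 'a \<Rightarrow> real) \<Rightarrow> 'a set"
  where "past_chron_boundary X d = {x \<in> X. chron_past X d x = {}}"

definition empty_bubbling_boundary :: "'a set \<Rightarrow> ('a \<Rightarrow> 'a \<Rightarrow> real) \<Rightarrow> bool"
  where "empty_bubbling_boundary X d \<longleftrightarrow>
    future_causal_boundary X d = future_chron_boundary X d \<and>
    past_causal_boundary X d = past_chron_boundary X d"

definition spacelike_boundary :: "'a set \<Rightarrow> ('a \<Rightarrow> 'a \<Rightarrow> real) \<Rightarrow> 'a set"
  where "spacelike_boundary X d = future_chron_boundary X d \<inter> past_chron_boundary X d"

text \<open>Intervals are nonempty and may be open, closed, half-open, bounded or unbounded. A curve is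
  a total function of which only the values on its interval matter.\<close>

definition real_interval :: "real set \<Rightarrow> bool"
  where "real_interval I \<longleftrightarrow> is_interval I \<and> I \<noteq> {}"

definition causal_curve ::
    "'a set \<Rightarrow> ('a \<Rightarrow> 'a \<Rightarrow> real) \<Rightarrow> 'a topology \<Rightarrow> real set \<Rightarrow> (real \<Rightarrow> 'a) \<Rightarrow> bool"
  where "causal_curve X d T I \<gamma> \<longleftrightarrow>
    real_interval I \<and> continuous_map (top_of_set I) T \<gamma> \<and>
    (\<forall>t\<in>I. \<forall>s\<in>I. t < s \<longrightarrow> causal_le X d (\<gamma> t) (\<gamma> s))"

definition causally_path_connected ::
    "'a set \<Rightarrow> ('a \<Rightarrow> 'a \<Rightarrow> real) \<Rightarrow> 'a topology \<Rightarrow> bool"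
  where "causally_path_connected X d T \<longleftrightarrow>
    (\<forall>x\<in>X. \<forall>y\<in>X. causal_le X d x y \<longrightarrow>
       (\<exists>a b \<gamma>. a \<le> b \<and> causal_curve X d T {a..b} \<gamma> \<and> \<gamma> a = x \<and> \<gamma> b = y))"

definition future_extendible ::
    "'a set \<Rightarrow> ('a \<Rightarrow> 'a \<Rightarrow> real) \<Rightarrow> 'a topology \<Rightarrow> real set \<Rightarrow> (real \<Rightarrow> 'a) \<Rightarrow> bool"
  where "future_extendible X d T I \<gamma> \<longleftrightarrow>
    (\<exists>I' I'' \<phi> \<psi> \<gamma>'.
       real_interval I' \<and> homeomorphism I I' \<phi> \<psi> \<and> strict_mono_on I \<phi> \<and>
       real_interval I'' \<and> I' \<subseteq> I'' \<and> (\<exists>t\<in>I''. \<forall>s\<in>I'. s < t) \<and>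
       causal_curve X d T I'' \<gamma>' \<and> (\<forall>s\<in>I'. \<gamma>' s = \<gamma> (\<psi> s)))"

definition past_extendible ::
    "'a set \<Rightarrow> ('a \<Rightarrow> 'a \<Rightarrow> real) \<Rightarrow> 'a topology \<Rightarrow> real set \<Rightarrow> (real \<Rightarrow> 'a) \<Rightarrow> bool"
  where "past_extendible X d T I \<gamma> \<longleftrightarrow>
    (\<exists>I' I'' \<phi> \<psi> \<gamma>'.
       real_interval I' \<and> homeomorphism I I' \<phi> \<psi> \<and> strict_mono_on I \<phi> \<and>
       real_interval I'' \<and> I' \<subseteq> I'' \<and> (\<exists>t\<in>I''. \<forall>s\<in>I'. t < s) \<and>
       causal_curve X d T I'' \<gamma>' \<and> (\<forall>s\<in>I'. \<gamma>' s = \<gamma> (\<psi> s)))"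

definition inextendible_causal_curve ::
    "'a set \<Rightarrow> ('a \<Rightarrow> 'a \<Rightarrow> real) \<Rightarrow> 'a topology \<Rightarrow> real set \<Rightarrow> (real \<Rightarrow> 'a) \<Rightarrow> bool"
  where "inextendible_causal_curve X d T I \<gamma> \<longleftrightarrow>
    causal_curve X d T I \<gamma> \<and> \<not> future_extendible X d T I \<gamma> \<and> \<not> past_extendible X d T I \<gamma>"

definition is_time_function ::
    "'a set \<Rightarrow> ('a \<Rightarrow> 'a \<Rightarrow> real) \<Rightarrow> 'a topology \<Rightarrow> ('a \<Rightarrow> ereal) \<Rightarrow> bool"
  where "is_time_function X d T \<tau> \<longleftrightarrow>
    continuous_map T euclidean \<tau> \<and>
    (\<forall>x\<in>X. \<forall>y\<in>X. causal_le X d x y \<and> x \<noteq> y \<longrightarrow> \<tau> x < \<tau> y)"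

text \<open>The endpoints of an interval may be infinite, so the one-sided limits at them are taken in
  the extended reals, within the image of the interval.\<close>

definition is_strong_cauchy_time_function ::
    "'a set \<Rightarrow> ('a \<Rightarrow> 'a \<Rightarrow> real) \<Rightarrow> 'a topology \<Rightarrow> ('a \<Rightarrow> ereal) \<Rightarrow> bool"
  where "is_strong_cauchy_time_function X d T \<tau> \<longleftrightarrow>
    is_time_function X d T \<tau> \<and>
    (\<forall>I \<gamma>. inextendible_causal_curve X d T I \<gamma> \<longrightarrow>
       ((\<lambda>t. \<tau> (\<gamma> (real_of_ereal t))) \<longlongrightarrow> -\<infinity>) (at (Inf (ereal ` I)) within ereal ` I) \<and>
       ((\<lambda>t. \<tau> (\<gamma> (real_of_ereal t))) \<longlongrightarrow> \<infinity>) (at (Sup (ereal ` I)) within ereal ` I))"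

end

theory Submission
  imports Defs
begin

text \<open>Replace the volumes in Geroch's construction by weighted sums of distances to a dense sequence
  \<open>c\<close>: \<open>past_weight x\<close> averages \<open>d (c n) x\<close> and \<open>future_weight x\<close> averages \<open>d x (c n)\<close>, and the time
  function is the logit of \<open>past_weight / (past_weight + future_weight)\<close>. The weights are monotone
  along the causal relation, and one of them is strictly so because \<open>d\<close> distinguishes points. They
  vanish exactly on the chronological boundaries; the absence of a spacelike boundary keeps the ratio
  defined, and the absence of a bubbling boundary keeps it strictly monotone up to the values
  \<open>\<plusminus>\<infinity>\<close>.

  If a causal curve \<open>\<gamma>\<close> satisfies \<open>d (\<gamma> t) x > 0\<close> for all \<open>t\<close>, it eventually stays in the compact
  diamond between one of its points and \<open>x\<close>. Any cluster point there is a least upper bound of the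
  curve for the causal order, hence unique, hence a limit, so \<open>\<gamma>\<close> is extendible. Thus along an
  inextendible curve each \<open>d (\<gamma> t) (c n)\<close> is eventually zero and the future weight tends to zero.\<close>

definition squash :: "real \<Rightarrow> real"
  where "squash u = u / (1 + \<bar>u\<bar>)"

lemma squash_0 [simp]: "squash 0 = 0"
  by (simp add: squash_def)

lemma abs_squash_le_1: "\<bar>squash u\<bar> \<le> 1"
  by (simp add: squash_def divide_simps)

lemma squash_le_iff: "0 \<le> u \<Longrightarrow> 0 \<le> v \<Longrightarrow> squash u \<le> squash v \<longleftrightarrow> u \<le> v"
  by (simp add: squash_def divide_simps algebra_simps)

lemma continuous_on_squash [continuous_intros]:
  "continuous_on A f \<Longrightarrow> continuous_on A (\<lambda>x. squash (f x))"
  unfolding squash_def by (intro continuous_intros) (auto simp: add_nonneg_eq_0_iff)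

definition weighted_sum :: "(nat \<Rightarrow> real) \<Rightarrow> real"
  where "weighted_sum u = (\<Sum>n. (1/2)^n * squash (u n))"

lemma norm_weighted_term: "norm ((1/2)^n * squash u) \<le> (1/2)^n"
  using abs_squash_le_1[of u] by (simp add: abs_mult mult_left_le)

lemma summable_weighted: "summable (\<lambda>n. (1/2)^n * squash (u n))"
  by (rule summable_comparison_test'[OF summable_geometric norm_weighted_term]) simp

lemma weighted_sum_mono:
  assumes "\<And>n. 0 \<le> u n" "\<And>n. u n \<le> v n"
  shows "weighted_sum u \<le> weighted_sum v"
proof -
  have "squash (u n) \<le> squash (v n)" for n
    using assms order_trans by (subst squash_le_iff) blast+
  then show ?thesis
    unfolding weighted_sum_def by (intro suminf_le summable_weighted mult_left_mono) auto
qed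

lemma weighted_sum_strict_mono:
  assumes "\<And>n. 0 \<le> u n" "\<And>n. u n \<le> v n" "u k < v k"
  shows "weighted_sum u < weighted_sum v"
proof -
  have v: "0 \<le> v n" for n using assms(1,2) order_trans by blast
  have "0 < (\<Sum>n. (1/2)^n * squash (v n) - (1/2)^n * squash (u n))"
  proof (rule suminf_pos2[where i=k])
    show "summable (\<lambda>n. (1/2)^n * squash (v n) - (1/2)^n * squash (u n))"
      by (intro summable_diff summable_weighted)
    show "0 \<le> (1/2)^n * squash (v n) - (1/2)^n * squash (u n)" for n
      using squash_le_iff[OF assms(1) v, of n n] assms(2) by (simp add: mult_left_mono)
    have "squash (u k) < squash (v k)"
      using squash_le_iff[OF v assms(1), of k k] assms(3) by linarith
    then show "0 < (1/2)^k * squash (v k) - (1/2)^k * squash (u k)"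
      by (simp add: mult_strict_left_mono)
  qed
  also have "\<dots> = weighted_sum v - weighted_sum u"
    unfolding weighted_sum_def by (rule suminf_diff[symmetric]; rule summable_weighted)
  finally show ?thesis by simp
qed

lemma weighted_sum_zero [simp]: "weighted_sum (\<lambda>n. 0) = 0"
  by (simp add: weighted_sum_def)

lemma weighted_sum_nonneg: "(\<And>n. 0 \<le> u n) \<Longrightarrow> 0 \<le> weighted_sum u"
  using weighted_sum_mono[of "\<lambda>n. 0" u] by simp

lemma weighted_sum_pos: "(\<And>n. 0 \<le> u n) \<Longrightarrow> 0 < u k \<Longrightarrow> 0 < weighted_sum u"
  using weighted_sum_strict_mono[of "\<lambda>n. 0" u] by simp

lemma continuous_on_weighted_sum: "continuous_on UNIV weighted_sum"
proof -
  have "uniform_limit UNIV (\<lambda>N u. \<Sum>n<N. (1/2)^n * squash (u n)) weighted_sum sequentially"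
    unfolding weighted_sum_def[abs_def]
    by (rule Weierstrass_m_test[OF norm_weighted_term]) (simp add: summable_geometric)
  moreover have "continuous_on UNIV (\<lambda>u. \<Sum>n<N. (1/2)^n * squash (u n))" for N :: nat
    by (intro continuous_intros continuous_on_product_coordinates)
  ultimately show ?thesis
    by (intro uniform_limit_theorem[OF always_eventually]) auto
qed

lemma tendsto_weighted_sum_zero:
  assumes "\<And>n. ((\<lambda>x. u x n) \<longlongrightarrow> 0) F"
  shows "((\<lambda>x. weighted_sum (u x)) \<longlongrightarrow> 0) F"
proof -
  have "limitin (product_topology (\<lambda>_. euclidean) UNIV) u (\<lambda>n. 0) F"
    using assms by (auto simp: limitin_componentwise)
  then have "(u \<longlongrightarrow> (\<lambda>n. 0)) F" by (simp add: euclidean_product_topology)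
  moreover have "isCont weighted_sum (\<lambda>n. 0)"
    using continuous_on_weighted_sum by (simp add: continuous_on_eq_continuous_at)
  ultimately show ?thesis
    using isCont_tendsto_compose[of "\<lambda>n. 0" weighted_sum u F] by simp
qed

definition extended_logit :: "real \<Rightarrow> ereal"
  where "extended_logit s = (if s \<le> 0 then -\<infinity> else if 1 \<le> s then \<infinity> else ereal (ln (s / (1 - s))))"

lemma extended_logit_strict_mono:
  assumes "s < t" "0 < t" "s < 1"
  shows "extended_logit s < extended_logit t"
proof (cases "0 < s \<and> t < 1")
  case True
  then have "s / (1 - s) < t / (1 - t)" using assms by (simp add: divide_simps algebra_simps)
  then show ?thesis using True assms by (simp add: extended_logit_def)
qed (use assms in \<open>auto simp: extended_logit_def\<close>)

lemma continuous_on_extended_logit: "continuous_on UNIV extended_logit"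
proof (rule continuous_onI_mono)
  have "y \<in> range extended_logit" for y
  proof (cases y)
    case (real r)
    define s where "s = exp r / (1 + exp r)"
    have pos: "1 + exp r > 0" by (simp add: add_pos_pos)
    have "0 < s" "s < 1" "s / (1 - s) = exp r"
      using pos by (auto simp: s_def divide_simps)
    then have "extended_logit s = y" by (simp add: extended_logit_def real)
    then show ?thesis by blast
  next
    case PInf
    then have "y = extended_logit 1" by (simp add: extended_logit_def)
    then show ?thesis by blast
  next
    case MInf
    then have "y = extended_logit 0" by (simp add: extended_logit_def)
    then show ?thesis by blast
  qed
  then show "open (range extended_logit)" by (metis UNIV_eq_I open_UNIV)
next
  fix s t :: real assume "s \<le> t"
  then show "extended_logit s \<le> extended_logit t"
    using extended_logit_strict_mono[of s t]
    by (cases "s = t"; cases "0 < t"; cases "s < 1") (auto simp: extended_logit_def)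
qed

lemma causal_le_dual: "causal_le X (\<lambda>x y. d y x) x y \<longleftrightarrow> causal_le X d y x"
  by (auto simp: causal_le_def)

lemma causal_le_refl [simp]: "causal_le X d x x"
  by (simp add: causal_le_def)

lemma real_interval_uminus [simp]: "real_interval (uminus ` I) \<longleftrightarrow> real_interval I"
  by (simp add: real_interval_def)

lemma causal_curve_dual:
  assumes "causal_curve X d T I \<gamma>"
  shows "causal_curve X (\<lambda>x y. d y x) T (uminus ` I) (\<lambda>t. \<gamma> (- t))"
proof -
  have "continuous_map (top_of_set (uminus ` I)) (top_of_set I) uminus"
    by (auto intro!: continuous_intros)
  then have "continuous_map (top_of_set (uminus ` I)) T (\<gamma> \<circ> uminus)"
    by (rule continuous_map_compose) (use assms in \<open>simp add: causal_curve_def\<close>)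
  then show ?thesis
    using assms by (auto simp: causal_curve_def comp_def causal_le_dual[of X d])
qed

lemma past_extendible_dual:
  assumes "future_extendible X (\<lambda>x y. d y x) T (uminus ` I) (\<lambda>t. \<gamma> (- t))"
  shows "past_extendible X d T I \<gamma>"
proof -
  from assms obtain I' I'' \<phi> \<psi> \<gamma>' t where *:
    "real_interval I'" "homeomorphism (uminus ` I) I' \<phi> \<psi>" "strict_mono_on (uminus ` I) \<phi>"
    "real_interval I''" "I' \<subseteq> I''" "t \<in> I''" "\<forall>s\<in>I'. s < t"
    "causal_curve X (\<lambda>x y. d y x) T I'' \<gamma>'" "\<forall>s\<in>I'. \<gamma>' s = \<gamma> (- \<psi> s)"
    unfolding future_extendible_def by blast
  have neg: "homeomorphism A (uminus ` A) uminus uminus" for A :: "real set"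
    by (auto simp: homeomorphism_def image_image intro!: continuous_intros)
  have neg': "homeomorphism (uminus ` A) A uminus uminus" for A :: "real set"
    by (auto simp: homeomorphism_def image_image intro!: continuous_intros)
  have "homeomorphism I (uminus ` I') (uminus \<circ> (\<phi> \<circ> uminus)) ((uminus \<circ> \<psi>) \<circ> uminus)"
    by (rule homeomorphism_compose[OF homeomorphism_compose[OF neg *(2)] neg])
  then have "homeomorphism I (uminus ` I') (\<lambda>t. - \<phi> (- t)) (\<lambda>t. - \<psi> (- t))"
    by (simp add: comp_def)
  moreover have "strict_mono_on I (\<lambda>t. - \<phi> (- t))"
    using *(3) by (auto simp: monotone_on_def)
  moreover have "causal_curve X d T (uminus ` I'') (\<lambda>t. \<gamma>' (- t))"
    using causal_curve_dual[OF *(8)] by simp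
  moreover have "- t \<in> uminus ` I''" "\<forall>s\<in>uminus ` I'. - t < s" using * by auto
  moreover have "\<forall>s\<in>uminus ` I'. \<gamma>' (- s) = \<gamma> (- \<psi> (- s))" using * by auto
  ultimately show ?thesis
    unfolding past_extendible_def
    using * by (intro exI[of _ "uminus ` I'"] exI[of _ "uminus ` I''"] exI[of _ "\<lambda>t. - \<phi> (- t)"]
        exI[of _ "\<lambda>t. - \<psi> (- t)"] exI[of _ "\<lambda>t. \<gamma>' (- t)"]) auto
qed

lemma future_extendible_if_max:
  assumes curve: "causal_curve X d T I \<gamma>" and m: "m \<in> I" "\<forall>t\<in>I. t \<le> m"
  shows "future_extendible X d T I \<gamma>"
proof -
  define J where "J = {s. \<exists>i\<in>I. i \<le> s}"
  have int: "is_interval I" using curve by (simp add: causal_curve_def real_interval_def)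
  have in_I: "min s m \<in> I" if "s \<in> J" for s
  proof -
    from that obtain i where i: "i \<in> I" "i \<le> s" by (auto simp: J_def)
    then show ?thesis using mem_is_interval_1_I[OF int i(1) m(1), of "min s m"] m by auto
  qed
  have "continuous_map (top_of_set J) (top_of_set I) (\<lambda>s. min s m)"
    using in_I by (auto intro!: continuous_intros)
  then have "continuous_map (top_of_set J) T (\<gamma> \<circ> (\<lambda>s. min s m))"
    by (rule continuous_map_compose) (use curve in \<open>simp add: causal_curve_def\<close>)
  moreover have "real_interval J"
    using m by (auto simp: real_interval_def is_interval_1 J_def intro: order_trans)
  moreover have "causal_le X d (\<gamma> (min t m)) (\<gamma> (min s m))" if "t \<in> J" "s \<in> J" "t < s" for s t
    using in_I[OF that(1)] in_I[OF that(2)] that(3) curve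
    by (cases "min t m = min s m") (auto simp: causal_curve_def)
  ultimately have "causal_curve X d T J (\<lambda>s. \<gamma> (min s m))"
    by (simp add: causal_curve_def comp_def)
  moreover have "homeomorphism I I id id" by (simp add: homeomorphism_def)
  moreover have "I \<subseteq> J" by (auto simp: J_def)
  moreover have "m + 1 \<in> J" using m(1) by (auto simp: J_def intro!: bexI[of _ m])
  moreover have "\<forall>s\<in>I. s < m + 1" using m(2) by fastforce
  moreover have "\<forall>s\<in>I. \<gamma> (min s m) = \<gamma> (id s)" using m by auto
  moreover have "strict_mono_on I id" by (simp add: monotone_on_def)
  moreover have "real_interval I" using curve by (simp add: causal_curve_def)
  ultimately show ?thesis
    unfolding future_extendible_def using \<open>real_interval J\<close> by blast
qed

lemma future_extendible_if_limit:
  assumes curve: "causal_curve X d T I \<gamma>" and nomax: "\<forall>m\<in>I. \<exists>t\<in>I. m < t"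
    and p: "p \<in> topspace T" "\<And>t. t \<in> I \<Longrightarrow> causal_le X d (\<gamma> t) p"
    and lim: "\<And>U. openin T U \<Longrightarrow> p \<in> U \<Longrightarrow> \<exists>s\<in>I. \<forall>t\<in>I. s \<le> t \<longrightarrow> \<gamma> t \<in> U"
  shows "future_extendible X d T I \<gamma>"
proof -
  define I' where "I' = arctan ` I"
  define J where "J = {s. \<exists>i\<in>I'. i \<le> s}"
  define \<gamma>' where "\<gamma>' s = (if s \<in> I' then \<gamma> (tan s) else p)" for s
  have int: "is_interval I" "I \<noteq> {}" and cont: "continuous_map (top_of_set I) T \<gamma>"
    using curve by (auto simp: causal_curve_def real_interval_def)
  have "connected I'" unfolding I'_def
    using int(1) by (intro connected_continuous_image continuous_intros) (simp add: is_interval_connected)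
  then have int': "is_interval I'" by (simp add: is_interval_connected_1)
  have "continuous_on I' tan"
    by (intro continuous_intros) (auto simp: I'_def cos_arctan_not_zero)
  then have homeo: "homeomorphism I I' arctan tan"
    by (auto simp: homeomorphism_def I'_def image_image tan_arctan intro!: continuous_intros)
  have nomax': "\<exists>u\<in>I'. s < u" if "s \<in> I'" for s
    using that nomax by (auto simp: I'_def arctan_less_iff)
  have down: "t \<in> I'" if ts: "t \<in> J" "s \<in> I'" "t \<le> s" for s t
  proof -
    obtain i where "i \<in> I'" "i \<le> t" using ts(1) by (auto simp: J_def)
    then show ?thesis using mem_is_interval_1_I[OF int' _ ts(2)] ts(3) by blast
  qed
  have sub: "I' \<subseteq> J" by (auto simp: J_def)
  have "I' = J \<inter> (\<Union>u\<in>I'. {..<u})"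
  proof (intro equalityI subsetI)
    fix s assume "s \<in> I'"
    then show "s \<in> J \<inter> (\<Union>u\<in>I'. {..<u})" using nomax' sub by blast
  next
    fix s assume "s \<in> J \<inter> (\<Union>u\<in>I'. {..<u})"
    then show "s \<in> I'" using down by (auto intro: less_imp_le)
  qed
  then have openI': "openin (top_of_set J) I'" by (metis open_UN open_lessThan openin_open_Int)
  have "continuous_map (top_of_set I') (top_of_set I) tan"
    using \<open>continuous_on I' tan\<close> by (auto simp: I'_def tan_arctan)
  then have contI': "continuous_map (top_of_set I') T (\<gamma> \<circ> tan)"
    by (rule continuous_map_compose) (rule cont)
  have "continuous_map (top_of_set J) T \<gamma>'"
    unfolding continuous_map_def
  proof (intro conjI allI impI funcsetI)
    fix s assume "s \<in> topspace (top_of_set J)"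
    then show "\<gamma>' s \<in> topspace T"
      using continuous_map_image_subset_topspace[OF contI'] p by (auto simp: \<gamma>'_def)
  next
    fix U assume U: "openin T U"
    have W: "openin (top_of_set J) {s \<in> I'. \<gamma> (tan s) \<in> U}"
      using openin_continuous_map_preimage[OF contI' U] openI' openin_trans by fastforce
    show "openin (top_of_set J) {x \<in> topspace (top_of_set J). \<gamma>' x \<in> U}"
    proof (cases "p \<in> U")
      case True
      then obtain t0 where t0: "t0 \<in> I" "\<forall>t\<in>I. t0 \<le> t \<longrightarrow> \<gamma> t \<in> U" using lim U by blast
      have inU: "\<gamma>' s \<in> U" if "arctan t0 < s" for s
        using that t0 True by (auto simp: \<gamma>'_def I'_def arctan_less_iff tan_arctan)
      have tail: "arctan t0 < s" if "s \<in> J" "s \<notin> I'" for s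
        using down[OF that(1), of "arctan t0"] that(2) t0(1) by (metis I'_def imageI not_le)
      have "{x \<in> topspace (top_of_set J). \<gamma>' x \<in> U} = {s \<in> I'. \<gamma> (tan s) \<in> U} \<union> J \<inter> {arctan t0<..}"
      proof (intro equalityI subsetI)
        fix s assume s: "s \<in> {x \<in> topspace (top_of_set J). \<gamma>' x \<in> U}"
        then show "s \<in> {s \<in> I'. \<gamma> (tan s) \<in> U} \<union> J \<inter> {arctan t0<..}"
          using tail by (cases "s \<in> I'") (auto simp: \<gamma>'_def)
      next
        fix s assume "s \<in> {s \<in> I'. \<gamma> (tan s) \<in> U} \<union> J \<inter> {arctan t0<..}"
        then show "s \<in> {x \<in> topspace (top_of_set J). \<gamma>' x \<in> U}"
          using inU[of s] sub by (auto simp: \<gamma>'_def split: if_splits)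
      qed
      then show ?thesis using W by (simp add: openin_Un openin_open_Int)
    next
      case False
      then have "{x \<in> topspace (top_of_set J). \<gamma>' x \<in> U} = {s \<in> I'. \<gamma> (tan s) \<in> U}"
        using sub by (auto simp: \<gamma>'_def split: if_splits)
      then show ?thesis using W by simp
    qed
  qed
  moreover have intJ: "real_interval J"
  proof -
    have "is_interval J"
      unfolding is_interval_1 J_def using order_trans by blast
    moreover have "J \<noteq> {}" using sub int(2) by (auto simp: I'_def)
    ultimately show ?thesis by (simp add: real_interval_def)
  qed
  moreover have "causal_le X d (\<gamma>' t) (\<gamma>' s)" if ts: "t \<in> J" "s \<in> J" "t < s" for s t
  proof (cases "s \<in> I'")
    case True
    moreover have "t \<in> I'" by (rule down[OF ts(1) True less_imp_le[OF ts(3)]])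
    ultimately obtain u v where uv: "u \<in> I" "v \<in> I" "t = arctan u" "s = arctan v"
      by (auto simp: I'_def)
    then have "causal_le X d (\<gamma> u) (\<gamma> v)"
      using ts(3) curve by (simp add: causal_curve_def arctan_less_iff)
    then show ?thesis using True \<open>t \<in> I'\<close> uv by (simp add: \<gamma>'_def tan_arctan)
  next
    case s: False
    show ?thesis
    proof (cases "t \<in> I'")
      case True
      then obtain u where "u \<in> I" "t = arctan u" by (auto simp: I'_def)
      then show ?thesis using True s p(2) by (simp add: \<gamma>'_def tan_arctan)
    qed (use s in \<open>simp add: \<gamma>'_def\<close>)
  qed
  ultimately have "causal_curve X d T J \<gamma>'" by (simp add: causal_curve_def)
  moreover have "pi/2 \<in> J" "\<forall>s\<in>I'. s < pi/2"
    using int(2) arctan_ubound by (auto simp: J_def I'_def intro: less_imp_le)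
  moreover have "\<forall>s\<in>I'. \<gamma>' s = \<gamma> (tan s)" by (simp add: \<gamma>'_def)
  moreover have "strict_mono_on I arctan" by (simp add: monotone_on_def arctan_less_iff)
  moreover have "real_interval I'" using int int' by (simp add: real_interval_def I'_def)
  ultimately show ?thesis
    unfolding future_extendible_def using homeo sub intJ by blast
qed


definition future_cluster_point :: "'a topology \<Rightarrow> real set \<Rightarrow> (real \<Rightarrow> 'a) \<Rightarrow> 'a \<Rightarrow> bool"
  where "future_cluster_point T I \<gamma> p \<longleftrightarrow>
    p \<in> topspace T \<and> (\<forall>U. openin T U \<and> p \<in> U \<longrightarrow> (\<forall>s\<in>I. \<exists>t\<in>I. s \<le> t \<and> \<gamma> t \<in> U))"

lemma compactin_future_cluster_point:
  assumes K: "compactin T K" and "I \<noteq> {}" and freq: "\<forall>s\<in>I. \<exists>t\<in>I. s \<le> t \<and> \<gamma> t \<in> K"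
  obtains p where "p \<in> K" "future_cluster_point T I \<gamma> p"
proof -
  define \<U> where "\<U> = {U. openin T U \<and> (\<exists>s\<in>I. \<forall>t\<in>I. s \<le> t \<longrightarrow> \<gamma> t \<notin> U)}"
  have "\<exists>p\<in>K. future_cluster_point T I \<gamma> p"
  proof (rule ccontr)
    assume *: "\<not> ?thesis"
    have "K \<subseteq> \<Union>\<U>"
    proof
      fix p assume "p \<in> K"
      then have "p \<in> topspace T" "\<not> future_cluster_point T I \<gamma> p"
        using compactin_subset_topspace[OF K] * by auto
      then obtain U s where "openin T U" "p \<in> U" "s \<in> I" "\<forall>t\<in>I. s \<le> t \<longrightarrow> \<gamma> t \<notin> U"
        unfolding future_cluster_point_def by metis
      then show "p \<in> \<Union>\<U>" by (auto simp: \<U>_def)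
    qed
    moreover have "\<forall>U\<in>\<U>. openin T U" by (simp add: \<U>_def)
    ultimately obtain \<F> where \<F>: "finite \<F>" "\<F> \<subseteq> \<U>" "K \<subseteq> \<Union>\<F>"
      using K unfolding compactin_def by meson
    from \<F>(1,2) have "\<exists>s\<in>I. \<forall>t\<in>I. s \<le> t \<longrightarrow> \<gamma> t \<notin> \<Union>\<F>"
    proof (induction rule: finite_induct)
      case empty
      then show ?case using \<open>I \<noteq> {}\<close> by auto
    next
      case (insert U \<F>)
      then obtain s where s: "s \<in> I" "\<forall>t\<in>I. s \<le> t \<longrightarrow> \<gamma> t \<notin> \<Union>\<F>" by auto
      from insert.prems obtain s' where "s' \<in> I" "\<forall>t\<in>I. s' \<le> t \<longrightarrow> \<gamma> t \<notin> U"
        by (auto simp: \<U>_def)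
      with s show ?case by (intro bexI[of _ "max s s'"]) (auto simp: max_def)
    qed
    then obtain s where s: "s \<in> I" "\<forall>t\<in>I. s \<le> t \<longrightarrow> \<gamma> t \<notin> \<Union>\<F>" by (rule bexE)
    from bspec[OF freq s(1)] obtain t where t: "t \<in> I" "s \<le> t" "\<gamma> t \<in> K" by (elim bexE conjE)
    then have "\<gamma> t \<notin> \<Union>\<F>" using s(2) by simp
    then show False using t(3) \<F>(3) by (meson subsetD)
  qed
  with that show ?thesis by blast
qed

lemma causal_curve_nonempty: "causal_curve X d T I \<gamma> \<Longrightarrow> I \<noteq> {}"
  by (simp add: causal_curve_def real_interval_def)

lemma causal_curve_le:
  "causal_curve X d T I \<gamma> \<Longrightarrow> s \<in> I \<Longrightarrow> t \<in> I \<Longrightarrow> s \<le> t \<Longrightarrow> causal_le X d (\<gamma> s) (\<gamma> t)"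
  by (cases "s = t") (auto simp: causal_curve_def)

locale continuous_lorentzian =
  fixes X :: "'a set" and d :: "'a \<Rightarrow> 'a \<Rightarrow> real" and T :: "'a topology"
  assumes nonneg: "x \<in> X \<Longrightarrow> y \<in> X \<Longrightarrow> 0 \<le> d x y"
    and reverse_triangle:
      "x \<in> X \<Longrightarrow> y \<in> X \<Longrightarrow> z \<in> X \<Longrightarrow> d x y > 0 \<Longrightarrow> d y z > 0 \<Longrightarrow> d x y + d y z \<le> d x z"
    and distinguishing:
      "x \<in> X \<Longrightarrow> y \<in> X \<Longrightarrow> x \<noteq> y \<Longrightarrow> \<exists>z\<in>X. d x z \<noteq> d y z \<or> d z x \<noteq> d z y"
    and topspace [simp]: "topspace T = X"
    and continuous: "continuous_map (prod_topology T T) euclideanreal (\<lambda>(x, y). d x y)"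
begin

lemma dual: "continuous_lorentzian X (\<lambda>x y. d y x) T"
proof
  have "continuous_map (prod_topology T T) euclideanreal ((\<lambda>(x, y). d x y) \<circ> prod.swap)"
    by (rule continuous_map_compose[OF _ continuous])
      (auto simp: prod.swap_def[abs_def] intro: continuous_map_pairedI continuous_map_fst continuous_map_snd)
  then show "continuous_map (prod_topology T T) euclideanreal (\<lambda>(x, y). d y x)"
    by (simp add: comp_def case_prod_unfold)
  show "d y x + d z y \<le> d z x" if "x \<in> X" "y \<in> X" "z \<in> X" "0 < d y x" "0 < d z y" for x y z
    using reverse_triangle[of z y x] that by simp
  show "\<exists>z\<in>X. d z x \<noteq> d z y \<or> d x z \<noteq> d y z" if "x \<in> X" "y \<in> X" "x \<noteq> y" for x y
    using distinguishing[OF that] by blast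
qed (use nonneg in auto)

lemma continuous_map_left:
  assumes "z \<in> X"
  shows "continuous_map T euclideanreal (\<lambda>x. d x z)"
proof -
  have "continuous_map T (prod_topology T T) (\<lambda>x. (x, z))"
    using assms by (intro continuous_map_pairedI) auto
  from continuous_map_compose[OF this continuous] show ?thesis by (simp add: comp_def)
qed

lemma continuous_map_right: "z \<in> X \<Longrightarrow> continuous_map T euclideanreal (\<lambda>x. d z x)"
  using continuous_lorentzian.continuous_map_left[OF dual] .

lemma causal_antisym:
  "x \<in> X \<Longrightarrow> y \<in> X \<Longrightarrow> causal_le X d x y \<Longrightarrow> causal_le X d y x \<Longrightarrow> x = y"
  using distinguishing[of x y] unfolding causal_le_def by (meson antisym)

lemma chron_imp_causal:
  assumes "x \<in> X" "y \<in> X" "d x y > 0"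
  shows "causal_le X d x y"
  unfolding causal_le_def
proof (intro ballI conjI)
  fix z assume z: "z \<in> X"
  show "d z x \<le> d z y"
    using reverse_triangle[OF z assms(1,2)] assms(3) nonneg[OF z assms(1)] nonneg[OF z assms(2)]
    by (cases "d z x = 0") auto
  show "d y z \<le> d x z"
    using reverse_triangle[OF assms(1,2) z] assms(3) nonneg[OF assms(2) z] nonneg[OF assms(1) z]
    by (cases "d y z = 0") auto
qed

lemma causal_curve_in: "causal_curve X d T I \<gamma> \<Longrightarrow> t \<in> I \<Longrightarrow> \<gamma> t \<in> X"
  using continuous_map_image_subset_topspace[of "top_of_set I" T \<gamma>]
  by (auto simp: causal_curve_def)

lemma open_superlevel:
  assumes "continuous_map T euclideanreal f"
  shows "openin T {x \<in> X. a < f x}" "openin T {x \<in> X. f x < a}"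
  using openin_continuous_map_preimage[OF assms, of "{a<..}"]
    openin_continuous_map_preimage[OF assms, of "{..<a}"] by auto

lemma cluster_point_least_upper_bound:
  assumes curve: "causal_curve X d T I \<gamma>" and p: "future_cluster_point T I \<gamma> p"
  shows "t \<in> I \<Longrightarrow> causal_le X d (\<gamma> t) p"
    and "q \<in> X \<Longrightarrow> (\<forall>t\<in>I. causal_le X d (\<gamma> t) q) \<Longrightarrow> causal_le X d p q"
proof -
  have pX: "p \<in> X" and hit: "\<And>U s. openin T U \<Longrightarrow> p \<in> U \<Longrightarrow> s \<in> I \<Longrightarrow> \<exists>t\<in>I. s \<le> t \<and> \<gamma> t \<in> U"
    using p by (auto simp: future_cluster_point_def)
  show "causal_le X d (\<gamma> t) p" if t: "t \<in> I"
    unfolding causal_le_def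
  proof (intro ballI conjI; rule ccontr)
    fix z assume z: "z \<in> X" and "\<not> d z (\<gamma> t) \<le> d z p"
    then obtain s where "s \<in> I" "t \<le> s" "d z (\<gamma> s) < d z (\<gamma> t)"
      using hit[OF open_superlevel(2)[OF continuous_map_right[OF z], of "d z (\<gamma> t)"] _ t] pX by auto
    then show False using causal_curve_le[OF curve t, of s] z by (force simp: causal_le_def)
  next
    fix z assume z: "z \<in> X" and "\<not> d p z \<le> d (\<gamma> t) z"
    then obtain s where "s \<in> I" "t \<le> s" "d (\<gamma> t) z < d (\<gamma> s) z"
      using hit[OF open_superlevel(1)[OF continuous_map_left[OF z], of "d (\<gamma> t) z"] _ t] pX by auto
    then show False using causal_curve_le[OF curve t, of s] z by (force simp: causal_le_def)
  qed
  obtain t0 where t0: "t0 \<in> I" using causal_curve_nonempty[OF curve] by blast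
  show "causal_le X d p q" if q: "q \<in> X" "\<forall>t\<in>I. causal_le X d (\<gamma> t) q"
    unfolding causal_le_def
  proof (intro ballI conjI; rule ccontr)
    fix z assume z: "z \<in> X" and "\<not> d z p \<le> d z q"
    then obtain s where "s \<in> I" "d z q < d z (\<gamma> s)"
      using hit[OF open_superlevel(1)[OF continuous_map_right[OF z], of "d z q"] _ t0] pX by auto
    then show False using q(2) z by (force simp: causal_le_def)
  next
    fix z assume z: "z \<in> X" and "\<not> d q z \<le> d p z"
    then obtain s where "s \<in> I" "d (\<gamma> s) z < d q z"
      using hit[OF open_superlevel(2)[OF continuous_map_left[OF z], of "d q z"] _ t0] pX by auto
    then show False using q(2) z by (force simp: causal_le_def)
  qed
qed

lemma future_extendible_if_eventually_compact:
  assumes curve: "causal_curve X d T I \<gamma>" and K: "compactin T K"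
    and t0: "t0 \<in> I" "\<forall>t\<in>I. t0 \<le> t \<longrightarrow> \<gamma> t \<in> K"
  shows "future_extendible X d T I \<gamma>"
proof (cases "\<forall>m\<in>I. \<exists>t\<in>I. m < t")
  case False
  then show ?thesis using future_extendible_if_max[OF curve] by (meson not_le)
next
  case nomax: True
  have I: "I \<noteq> {}" using t0 by auto
  have max_in: "max s t0 \<in> I" if "s \<in> I" for s using that t0(1) by (simp add: max_def)
  have "\<forall>s\<in>I. \<exists>t\<in>I. s \<le> t \<and> \<gamma> t \<in> K"
    using t0(2) max_in max.cobounded1 max.cobounded2 by metis
  then obtain p where p: "future_cluster_point T I \<gamma> p"
    using compactin_future_cluster_point[OF K I] by blast
  show ?thesis
  proof (rule future_extendible_if_limit[OF curve nomax])
    show "p \<in> topspace T" using p by (simp add: future_cluster_point_def)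
    show "causal_le X d (\<gamma> t) p" if "t \<in> I" for t
      using cluster_point_least_upper_bound(1)[OF curve p that] .
    fix U assume U: "openin T U" "p \<in> U"
    show "\<exists>s\<in>I. \<forall>t\<in>I. s \<le> t \<longrightarrow> \<gamma> t \<in> U"
    proof (rule ccontr)
      assume *: "\<not> ?thesis"
      have "compactin T ((topspace T - U) \<inter> K)"
        by (rule closed_Int_compactin[OF closedin_diff[OF closedin_topspace U(1)] K])
      moreover have "\<exists>t\<in>I. s \<le> t \<and> \<gamma> t \<in> (topspace T - U) \<inter> K" if s: "s \<in> I" for s
      proof -
        obtain t where t: "t \<in> I" "max s t0 \<le> t" "\<gamma> t \<notin> U"
          using * max_in[OF s] by blast
        then have "\<gamma> t \<in> (topspace T - U) \<inter> K"
          using t0(2) causal_curve_in[OF curve t(1)] by simp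
        then show ?thesis using t by (intro bexI[of _ t]) simp_all
      qed
      ultimately obtain q where q: "q \<in> (topspace T - U) \<inter> K" "future_cluster_point T I \<gamma> q"
        using compactin_future_cluster_point[OF _ I, of T "(topspace T - U) \<inter> K" \<gamma>] by blast
      have X: "p \<in> X" "q \<in> X" using p q(2) by (simp_all add: future_cluster_point_def)
      have "causal_le X d p q"
        by (rule cluster_point_least_upper_bound(2)[OF curve p X(2)])
          (intro ballI cluster_point_least_upper_bound(1)[OF curve q(2)])
      moreover have "causal_le X d q p"
        by (rule cluster_point_least_upper_bound(2)[OF curve q(2) X(1)])
          (intro ballI cluster_point_least_upper_bound(1)[OF curve p])
      ultimately have "p = q" using causal_antisym[OF X] by blast
      then show False using q(1) U(2) by blast
    qed
  qed
qed

lemma inextendible_leaves_chron_past: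
  assumes curve: "causal_curve X d T I \<gamma>" and inext: "\<not> future_extendible X d T I \<gamma>"
    and diamonds: "compact_causal_diamonds X d T" and x: "x \<in> X"
  shows "\<exists>t\<in>I. \<forall>s\<in>I. t \<le> s \<longrightarrow> d (\<gamma> s) x = 0"
proof (rule ccontr)
  assume *: "\<not> ?thesis"
  note inX = causal_curve_in[OF curve]
  obtain t0 where t0: "t0 \<in> I" using causal_curve_nonempty[OF curve] by blast
  have pos: "0 < d (\<gamma> t) x" if t: "t \<in> I" for t
  proof -
    from * t obtain s where s: "s \<in> I" "t \<le> s" "d (\<gamma> s) x \<noteq> 0" by blast
    then have "0 < d (\<gamma> s) x" using nonneg[OF inX[OF s(1)] x] by simp
    also have "\<dots> \<le> d (\<gamma> t) x" using causal_curve_le[OF curve t s(1,2)] x by (simp add: causal_le_def)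
    finally show ?thesis .
  qed
  have "compactin T (causal_future X d (\<gamma> t0) \<inter> causal_past X d x)"
    using diamonds inX[OF t0] x by (simp add: compact_causal_diamonds_def)
  moreover have "\<gamma> t \<in> causal_future X d (\<gamma> t0) \<inter> causal_past X d x" if "t \<in> I" "t0 \<le> t" for t
    using causal_curve_le[OF curve t0 that] chron_imp_causal[OF inX[OF that(1)] x pos[OF that(1)]]
      inX[OF that(1)] by (simp add: causal_future_def causal_past_def)
  ultimately show False using future_extendible_if_eventually_compact[OF curve _ t0] inext by blast
qed

lemma inextendible_not_constant:
  assumes curve: "causal_curve X d T I \<gamma>" and inext: "\<not> future_extendible X d T I \<gamma>"
  shows "\<exists>t\<in>I. \<exists>s\<in>I. t < s \<and> \<gamma> t \<noteq> \<gamma> s"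
proof (rule ccontr)
  assume const: "\<not> ?thesis"
  obtain t0 where t0: "t0 \<in> I" using causal_curve_nonempty[OF curve] by blast
  have "compactin T {\<gamma> t0}" using causal_curve_in[OF curve t0] by simp
  moreover have "\<gamma> t \<in> {\<gamma> t0}" if "t \<in> I" "t0 \<le> t" for t
    using const t0 that by (cases "t = t0") auto
  ultimately show False
    using future_extendible_if_eventually_compact[OF curve _ t0, of "{\<gamma> t0}"] inext by blast
qed

end

locale dense_sequence = continuous_lorentzian +
  fixes c :: "nat \<Rightarrow> 'a"
  assumes range_c: "c n \<in> X"
    and dense: "openin T U \<Longrightarrow> U \<noteq> {} \<Longrightarrow> \<exists>n. c n \<in> U"
begin

definition future_weight :: "'a \<Rightarrow> real"
  where "future_weight x = weighted_sum (\<lambda>n. d x (c n))"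

definition past_weight :: "'a \<Rightarrow> real"
  where "past_weight x = weighted_sum (\<lambda>n. d (c n) x)"

lemma dual_dense: "dense_sequence X (\<lambda>x y. d y x) T c"
  using dual range_c dense by (simp add: dense_sequence_def dense_sequence_axioms_def)

lemma dual_weight:
  "dense_sequence.future_weight (\<lambda>x y. d y x) c = past_weight"
  "dense_sequence.past_weight (\<lambda>x y. d y x) c = future_weight"
  by (rule ext,
      simp add: dense_sequence.future_weight_def[OF dual_dense] dense_sequence.past_weight_def[OF dual_dense]
      future_weight_def past_weight_def)+

lemma continuous_map_future_weight: "continuous_map T euclideanreal future_weight"
proof -
  have "continuous_map T (product_topology (\<lambda>_. euclidean) UNIV) (\<lambda>x n. d x (c n))"
    using continuous_map_left range_c by (simp add: continuous_map_componentwise_UNIV)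
  then have "continuous_map T euclidean (\<lambda>x n. d x (c n))" by (simp add: euclidean_product_topology)
  moreover have "continuous_map euclidean euclideanreal weighted_sum"
    using continuous_on_weighted_sum by simp
  ultimately show ?thesis
    unfolding future_weight_def[abs_def] by (rule continuous_map_compose[unfolded comp_def])
qed

lemma future_weight_nonneg: "x \<in> X \<Longrightarrow> 0 \<le> future_weight x"
  unfolding future_weight_def using nonneg range_c by (intro weighted_sum_nonneg) auto

lemma future_weight_antimono:
  "y \<in> X \<Longrightarrow> causal_le X d x y \<Longrightarrow> future_weight y \<le> future_weight x"
  unfolding future_weight_def
  using nonneg range_c by (intro weighted_sum_mono) (auto simp: causal_le_def)

lemma future_weight_pos:
  assumes x: "x \<in> X" and "x \<notin> future_chron_boundary X d"
  shows "0 < future_weight x"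
proof -
  obtain y where "y \<in> X" "0 < d x y"
    using assms by (auto simp: future_chron_boundary_def chron_future_def)
  then have "{z \<in> X. 0 < d x z} \<noteq> {}" by blast
  then obtain n where "0 < d x (c n)"
    using dense[OF open_superlevel(1)[OF continuous_map_right[OF x]]] by blast
  then show ?thesis
    unfolding future_weight_def by (rule weighted_sum_pos[OF nonneg[OF x range_c]])
qed

lemma future_weight_strict:
  assumes X: "x \<in> X" "y \<in> X" "z \<in> X" and le: "causal_le X d x y" and less: "d y z < d x z"
  shows "future_weight y < future_weight x"
proof -
  have "continuous_map T euclideanreal (\<lambda>w. d x w - d y w)"
    using X by (intro continuous_map_diff continuous_map_right)
  moreover have "{w \<in> X. 0 < d x w - d y w} \<noteq> {}" using X(3) less by force
  ultimately obtain n where "0 < d x (c n) - d y (c n)"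
    using dense[OF open_superlevel(1)] by blast
  then have "d y (c n) < d x (c n)" by simp
  then show ?thesis
    unfolding future_weight_def
    using nonneg range_c X le by (intro weighted_sum_strict_mono[where k=n]) (auto simp: causal_le_def)
qed

lemmas continuous_map_past_weight =
  dense_sequence.continuous_map_future_weight[OF dual_dense, unfolded dual_weight]

lemmas past_weight_nonneg =
  dense_sequence.future_weight_nonneg[OF dual_dense, unfolded dual_weight]

lemma past_weight_mono:
  "x \<in> X \<Longrightarrow> causal_le X d x y \<Longrightarrow> past_weight x \<le> past_weight y"
  using dense_sequence.future_weight_antimono[OF dual_dense, unfolded dual_weight]
  by (simp add: causal_le_dual[of X d])

lemma past_weight_pos: "x \<in> X \<Longrightarrow> x \<notin> past_chron_boundary X d \<Longrightarrow> 0 < past_weight x"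
  using dense_sequence.future_weight_pos[OF dual_dense, unfolded dual_weight]
  by (simp add: future_chron_boundary_def past_chron_boundary_def chron_future_def chron_past_def)

lemma past_weight_strict:
  "x \<in> X \<Longrightarrow> y \<in> X \<Longrightarrow> z \<in> X \<Longrightarrow> causal_le X d x y \<Longrightarrow> d z x < d z y \<Longrightarrow> past_weight x < past_weight y"
  using dense_sequence.future_weight_strict[OF dual_dense, unfolded dual_weight]
  by (simp add: causal_le_dual[of X d])

lemma weight_strict:
  assumes "x \<in> X" "y \<in> X" "causal_le X d x y" "x \<noteq> y"
  shows "past_weight x < past_weight y \<or> future_weight y < future_weight x"
proof -
  obtain z where z: "z \<in> X" "d x z \<noteq> d y z \<or> d z x \<noteq> d z y"
    using distinguishing[OF assms(1,2,4)] by blast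
  moreover have "d z x \<le> d z y" "d y z \<le> d x z"
    using assms(3) z(1) by (auto simp: causal_le_def)
  ultimately show ?thesis
    using future_weight_strict[OF assms(1,2) z(1) assms(3)]
      past_weight_strict[OF assms(1,2) z(1) assms(3)] by linarith
qed

definition weight_ratio :: "'a \<Rightarrow> real"
  where "weight_ratio x = past_weight x / (past_weight x + future_weight x)"

definition cauchy_time :: "'a \<Rightarrow> ereal"
  where "cauchy_time x = extended_logit (weight_ratio x)"

end

locale globally_hyperbolic_lorentzian = dense_sequence +
  assumes diamonds: "compact_causal_diamonds X d T"
    and bubbling: "empty_bubbling_boundary X d"
    and spacelike: "spacelike_boundary X d = {}"
begin

lemma dual_globally_hyperbolic: "globally_hyperbolic_lorentzian X (\<lambda>x y. d y x) T c"
proof -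
  have "compact_causal_diamonds X (\<lambda>x y. d y x) T"
    using diamonds by (auto simp: compact_causal_diamonds_def causal_future_def causal_past_def
        Int_commute causal_le_dual[of X d])
  moreover have "empty_bubbling_boundary X (\<lambda>x y. d y x)"
    using bubbling by (simp add: empty_bubbling_boundary_def future_causal_boundary_def
        past_causal_boundary_def future_chron_boundary_def past_chron_boundary_def
        causal_future_def causal_past_def chron_future_def chron_past_def causal_le_dual[of X d])
  moreover have "spacelike_boundary X (\<lambda>x y. d y x) = {}"
    using spacelike by (simp add: spacelike_boundary_def future_chron_boundary_def
        past_chron_boundary_def chron_future_def chron_past_def Int_commute)
  ultimately show ?thesis
    using dual_dense
    by (simp add: globally_hyperbolic_lorentzian_def globally_hyperbolic_lorentzian_axioms_def)
qed

lemma future_weight_pos_if_below: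
  assumes "x \<in> X" "y \<in> X" "causal_le X d x y" "x \<noteq> y"
  shows "0 < future_weight x"
proof -
  have "x \<notin> future_causal_boundary X d"
    using assms by (auto simp: future_causal_boundary_def causal_future_def)
  then show ?thesis
    using bubbling future_weight_pos[OF assms(1)] by (simp add: empty_bubbling_boundary_def)
qed

lemma past_weight_pos_if_above:
  assumes "x \<in> X" "y \<in> X" "causal_le X d x y" "x \<noteq> y"
  shows "0 < past_weight y"
  using globally_hyperbolic_lorentzian.future_weight_pos_if_below[OF dual_globally_hyperbolic, of y x] assms
  by (simp add: dual_weight causal_le_dual[of X d])

lemma weights_pos:
  assumes "x \<in> X"
  shows "0 < past_weight x + future_weight x"
proof -
  have "x \<notin> future_chron_boundary X d \<or> x \<notin> past_chron_boundary X d"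
    using spacelike by (auto simp: spacelike_boundary_def)
  then show ?thesis
    using future_weight_pos[OF assms] past_weight_pos[OF assms]
      future_weight_nonneg[OF assms] past_weight_nonneg[OF assms] by linarith
qed

lemma cauchy_time_strict_mono:
  assumes "x \<in> X" "y \<in> X" "causal_le X d x y" "x \<noteq> y"
  shows "cauchy_time x < cauchy_time y"
proof -
  define a b a' b' where ab: "a = past_weight x" "b = future_weight x"
    "a' = past_weight y" "b' = future_weight y"
  have b: "0 < b" and a': "0 < a'"
    using future_weight_pos_if_below[OF assms] past_weight_pos_if_above[OF assms] by (simp_all add: ab)
  have nn: "0 \<le> a" "0 \<le> b'"
    using past_weight_nonneg future_weight_nonneg assms by (simp_all add: ab)
  have le: "a \<le> a'" "b' \<le> b"
    using past_weight_mono[of x y] future_weight_antimono[of y x] assms by (simp_all add: ab)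
  have "a < a' \<or> b' < b" using weight_strict[OF assms] by (simp add: ab)
  then have "a * b' < a' * b"
  proof
    assume "a < a'"
    have "a * b' \<le> a * b" using nn le by (intro mult_left_mono)
    also have "\<dots> < a' * b" using \<open>a < a'\<close> b by simp
    finally show ?thesis .
  next
    assume "b' < b"
    have "a * b' \<le> a' * b'" using nn le by (intro mult_right_mono)
    also have "\<dots> < a' * b" using \<open>b' < b\<close> a' by simp
    finally show ?thesis .
  qed
  then have "a / (a + b) < a' / (a' + b')"
    using nn a' b by (simp add: divide_simps add_nonneg_pos add_pos_nonneg algebra_simps)
  moreover have "0 < a' / (a' + b')" "a / (a + b) < 1"
    using nn a' b by (simp_all add: divide_simps add_nonneg_pos add_pos_nonneg)
  ultimately show ?thesis
    unfolding cauchy_time_def weight_ratio_def using ab by (intro extended_logit_strict_mono) auto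
qed

lemma continuous_map_cauchy_time: "continuous_map T euclidean cauchy_time"
proof -
  have "continuous_map T euclideanreal weight_ratio"
    unfolding weight_ratio_def[abs_def]
    using weights_pos
    by (intro continuous_map_real_divide continuous_map_add continuous_map_past_weight
        continuous_map_future_weight) force+
  moreover have "continuous_map euclideanreal euclidean extended_logit"
    using continuous_on_extended_logit by simp
  ultimately show ?thesis
    unfolding cauchy_time_def[abs_def] by (rule continuous_map_compose[unfolded comp_def])
qed

lemma tendsto_cauchy_time:
  assumes "((weight_ratio \<circ> f) \<longlongrightarrow> l) F"
  shows "((\<lambda>t. cauchy_time (f t)) \<longlongrightarrow> extended_logit l) F"
proof -
  have "isCont extended_logit l"
    using continuous_on_extended_logit by (simp add: continuous_on_eq_continuous_at)
  then show ?thesis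
    unfolding cauchy_time_def using isCont_tendsto_compose[of l extended_logit] assms by (simp add: comp_def)
qed

lemma future_weight_tendsto_0:
  assumes curve: "causal_curve X d T I \<gamma>" and inext: "\<not> future_extendible X d T I \<gamma>"
    and F: "\<And>t. t \<in> I \<Longrightarrow> eventually (\<lambda>e. \<exists>s\<in>I. t \<le> s \<and> f e = \<gamma> s) F"
  shows "((\<lambda>e. future_weight (f e)) \<longlongrightarrow> 0) F"
    and "\<exists>\<delta>>0. eventually (\<lambda>e. \<delta> \<le> past_weight (f e)) F"
proof -
  have "((\<lambda>e. d (f e) (c n)) \<longlongrightarrow> 0) F" for n
  proof -
    obtain t where "t \<in> I" "\<forall>s\<in>I. t \<le> s \<longrightarrow> d (\<gamma> s) (c n) = 0"
      using inextendible_leaves_chron_past[OF curve inext diamonds range_c] by blast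
    then have "eventually (\<lambda>e. d (f e) (c n) = 0) F"
      using F[of t] by (auto elim!: eventually_mono)
    then show ?thesis by (rule tendsto_eventually)
  qed
  then show "((\<lambda>e. future_weight (f e)) \<longlongrightarrow> 0) F"
    unfolding future_weight_def by (rule tendsto_weighted_sum_zero)
  note inX = causal_curve_in[OF curve]
  obtain t s where ts: "t \<in> I" "s \<in> I" "t < s" "\<gamma> t \<noteq> \<gamma> s"
    using inextendible_not_constant[OF curve inext] by blast
  then have "0 < past_weight (\<gamma> s)"
    using past_weight_pos_if_above[of "\<gamma> t" "\<gamma> s"] inX causal_curve_le[OF curve, of t s] by auto
  moreover have "eventually (\<lambda>e. past_weight (\<gamma> s) \<le> past_weight (f e)) F"
    using F[OF ts(2)] past_weight_mono inX ts(2) causal_curve_le[OF curve ts(2)]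
    by (auto elim!: eventually_mono)
  ultimately show "\<exists>\<delta>>0. eventually (\<lambda>e. \<delta> \<le> past_weight (f e)) F" by blast
qed

end

lemma tendsto_ratio_0:
  fixes u v :: "'b \<Rightarrow> real"
  assumes u: "(u \<longlongrightarrow> 0) F" and v: "\<exists>\<delta>>0. eventually (\<lambda>e. \<delta> \<le> v e) F"
    and nn: "eventually (\<lambda>e. 0 \<le> u e) F"
  shows "((\<lambda>e. u e / (u e + v e)) \<longlongrightarrow> 0) F"
proof -
  obtain \<delta> where \<delta>: "0 < \<delta>" "eventually (\<lambda>e. \<delta> \<le> v e) F" using v by blast
  have "((\<lambda>e. u e / \<delta>) \<longlongrightarrow> 0) F" using tendsto_divide[OF u tendsto_const, of \<delta>] \<delta> by simp
  moreover have "eventually (\<lambda>e. norm (u e / (u e + v e)) \<le> u e / \<delta>) F"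
    using nn \<delta>(2) by eventually_elim (use \<delta>(1) in \<open>auto intro!: divide_left_mono\<close>)
  ultimately show ?thesis by (rule Lim_null_comparison[rotated])
qed

lemma eventually_at_Sup_ereal:
  assumes nomax: "\<forall>m\<in>I. \<exists>t\<in>I. m < t" and t: "t \<in> I"
  shows "eventually (\<lambda>e. \<exists>s\<in>I. t \<le> s \<and> e = ereal s) (at (Sup (ereal ` I)) within ereal ` I)"
proof -
  obtain t' where "t' \<in> I" "t < t'" using nomax t by blast
  then have "ereal t < Sup (ereal ` I)" by (simp add: less_SUP_iff) blast
  then show ?thesis
    unfolding eventually_at_topological
    by (intro exI[of _ "{ereal t<..}"]) auto
qed

lemma eventually_at_Inf_ereal:
  assumes nomin: "\<forall>m\<in>I. \<exists>t\<in>I. t < m" and t: "t \<in> I"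
  shows "eventually (\<lambda>e. \<exists>s\<in>I. s \<le> t \<and> e = ereal s) (at (Inf (ereal ` I)) within ereal ` I)"
proof -
  obtain t' where "t' \<in> I" "t' < t" using nomin t by blast
  then have "Inf (ereal ` I) < ereal t" by (simp add: INF_less_iff) blast
  then show ?thesis
    unfolding eventually_at_topological
    by (intro exI[of _ "{..<ereal t}"]) auto
qed

context globally_hyperbolic_lorentzian
begin

lemma cauchy_time_tendsto_PInf:
  assumes curve: "causal_curve X d T I \<gamma>" and inext: "\<not> future_extendible X d T I \<gamma>"
  shows "((\<lambda>e. cauchy_time (\<gamma> (real_of_ereal e))) \<longlongrightarrow> \<infinity>) (at (Sup (ereal ` I)) within ereal ` I)"
    (is "(_ \<longlongrightarrow> _) ?F")
proof -
  let ?f = "\<lambda>e. \<gamma> (real_of_ereal e)"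
  have nomax: "\<forall>m\<in>I. \<exists>t\<in>I. m < t"
    using future_extendible_if_max[OF curve] inext by (meson not_le)
  have F: "eventually (\<lambda>e. \<exists>s\<in>I. t \<le> s \<and> ?f e = \<gamma> s) ?F" if "t \<in> I" for t
    using eventually_at_Sup_ereal[OF nomax that] by (auto elim!: eventually_mono)
  have inX: "eventually (\<lambda>e. ?f e \<in> X) ?F"
    using causal_curve_in[OF curve] by (auto simp: eventually_at_filter intro!: always_eventually)
  have "((\<lambda>e. future_weight (?f e) / (future_weight (?f e) + past_weight (?f e))) \<longlongrightarrow> 0) ?F"
    using inX by (intro tendsto_ratio_0 future_weight_tendsto_0[OF curve inext F])
      (auto elim!: eventually_mono simp: future_weight_nonneg)
  then have "((\<lambda>e. 1 - future_weight (?f e) / (future_weight (?f e) + past_weight (?f e))) \<longlongrightarrow> 1) ?F"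
    using tendsto_diff[OF tendsto_const[of "1::real"]] by fastforce
  moreover have "eventually (\<lambda>e. 1 - future_weight (?f e) / (future_weight (?f e) + past_weight (?f e))
      = (weight_ratio \<circ> ?f) e) ?F"
    using inX
  proof eventually_elim
    case (elim e)
    then show ?case using weights_pos[of "?f e"] by (simp add: weight_ratio_def field_simps)
  qed
  ultimately have "((weight_ratio \<circ> ?f) \<longlongrightarrow> 1) ?F" by (rule Lim_transform_eventually)
  from tendsto_cauchy_time[OF this] show ?thesis by (simp add: extended_logit_def)
qed

lemma cauchy_time_tendsto_MInf:
  assumes curve: "causal_curve X d T I \<gamma>" and inext: "\<not> past_extendible X d T I \<gamma>"
  shows "((\<lambda>e. cauchy_time (\<gamma> (real_of_ereal e))) \<longlongrightarrow> -\<infinity>) (at (Inf (ereal ` I)) within ereal ` I)"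
    (is "(_ \<longlongrightarrow> _) ?F")
proof -
  let ?f = "\<lambda>e. \<gamma> (real_of_ereal e)"
  interpret D: globally_hyperbolic_lorentzian X "\<lambda>x y. d y x" T c
    by (rule dual_globally_hyperbolic)
  note curve' = causal_curve_dual[OF curve]
  have inext': "\<not> future_extendible X (\<lambda>x y. d y x) T (uminus ` I) (\<lambda>t. \<gamma> (- t))"
    using past_extendible_dual inext by blast
  have "\<forall>m\<in>uminus ` I. \<exists>t\<in>uminus ` I. m < t"
    using future_extendible_if_max[OF curve'] inext' by (meson not_le)
  then have nomin: "\<forall>m\<in>I. \<exists>t\<in>I. t < m" by auto
  have F: "eventually (\<lambda>e. \<exists>s\<in>uminus ` I. t \<le> s \<and> ?f e = \<gamma> (- s)) ?F" if "t \<in> uminus ` I" for t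
    using eventually_at_Inf_ereal[OF nomin, of "- t"] that by (fastforce elim!: eventually_mono)
  have inX: "eventually (\<lambda>e. ?f e \<in> X) ?F"
    using causal_curve_in[OF curve] by (auto simp: eventually_at_filter intro!: always_eventually)
  have "((\<lambda>e. past_weight (?f e) / (past_weight (?f e) + future_weight (?f e))) \<longlongrightarrow> 0) ?F"
    using inX by (intro tendsto_ratio_0 D.future_weight_tendsto_0[OF curve' inext' F, unfolded dual_weight])
      (auto elim!: eventually_mono simp: past_weight_nonneg)
  then have "((weight_ratio \<circ> ?f) \<longlongrightarrow> 0) ?F" by (simp add: weight_ratio_def comp_def)
  from tendsto_cauchy_time[OF this] show ?thesis by (simp add: extended_logit_def)
qed

lemma strong_cauchy_time: "is_strong_cauchy_time_function X d T cauchy_time"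
  unfolding is_strong_cauchy_time_function_def is_time_function_def inextendible_causal_curve_def
  using continuous_map_cauchy_time cauchy_time_strict_mono
    cauchy_time_tendsto_PInf cauchy_time_tendsto_MInf by auto

end

theorem theoremA2:
  fixes X :: "'a set" and d :: "'a \<Rightarrow> 'a \<Rightarrow> real" and T :: "'a topology"
  assumes "lorentzian_metric_space X d"
    and "admissible_topology X d T"
    and "separable_space T"
    and "first_countable T"
    and "causally_path_connected X d T"
    and "compact_causal_diamonds X d T"
    and "empty_bubbling_boundary X d"
    and "spacelike_boundary X d = {}"
  shows "\<exists>\<tau>. is_strong_cauchy_time_function X d T \<tau>"
proof -
  interpret lorentzian_metric_space X d by fact
  interpret continuous_lorentzian X d T
    using nonneg reverse_triangle distinguishing assms(2)
    by unfold_locales (auto simp: admissible_topology_def)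
  obtain C where C: "countable C" "C \<subseteq> X" "T closure_of C = X"
    using assms(3) by (auto simp: separable_space_def)
  show ?thesis
  proof (cases "X = {}")
    case True
    then have "continuous_map T euclidean (\<lambda>_. 0 :: ereal)" by simp
    moreover have "\<not> causal_curve X d T I \<gamma>" for I \<gamma>
      using True causal_curve_in[of I \<gamma>] by (auto simp: causal_curve_def real_interval_def)
    ultimately show ?thesis
      using True by (auto simp: is_strong_cauchy_time_function_def is_time_function_def
          inextendible_causal_curve_def intro!: exI[of _ "\<lambda>_. 0"])
  next
    case False
    then have "C \<noteq> {}" using C by auto
    interpret globally_hyperbolic_lorentzian X d T "from_nat_into C"
    proof
      show "from_nat_into C n \<in> X" for n using from_nat_into[OF \<open>C \<noteq> {}\<close>] C by blast
      fix U assume U: "openin T U" "U \<noteq> {}"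
      then have "U \<subseteq> T closure_of C" using C(3) openin_subset by fastforce
      then obtain x where "x \<in> C" "x \<in> U" using U unfolding closure_of_def by blast
      then show "\<exists>n. from_nat_into C n \<in> U" using from_nat_into_surj[OF C(1)] by metis
    qed fact+
    show ?thesis using strong_cauchy_time by blast
  qed
qed

end
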